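(* Let $(A,M,\{P_x\}_{x\in X})$ be a matching relative Rota-Baxter algebra and let $(M,\{\prec_x,\succ_x\}_{x\in X})$ be the induced matching dendriform algebra, $u\prec_xv=u\cdot_MP_x(v)$, $u\succ_xv=P_x(u)\cdot_Mv$. For $n\ge1$ define $\theta_n:C^n_{\{P_x\}}(M,A)\to C^{n+1}_{\mathrm{mDA}}(M,\{\prec_x,\succ_x\}_{x\in X})$ by $$(\theta_n(f))^{[r]}_{x_1,\dots,x_{n+1}}(u_1,\dots,u_{n+1})=\begin{cases}(-1)^{n+1}\,u_1\cdot_Mf_{x_2,\dots,x_{n+1}}(u_2,\dots,u_{n+1}),&r=1,\\ 0,&2\le r\le n,\\ f_{x_1,\dots,x_n}(u_1,\dots,u_n)\cdot_Mu_{n+1},&r=n+1.\end{cases}$$ (i) The collection $\{\theta_n\}_{n\ge1}$ is a graded Lie algebra morphism from $(\oplus_{n\ge1}C^n_{\{P_x\}}(M,A),[\![~,~]\!])$ to $(\oplus_{n\ge 1}C^{n+1}_{\mathrm{mDA}}(M,\{\prec_x,\succ_x\}_{x\in X}),\{\!\!\{~,~\}\!\!\})$. (ii) The collection $\{\theta_n\}_{n\ge1}$ induces a morphism $\theta_\bullet:H^\bullet_{\{P_x\}}(M,A)\to H^{\bullet+1}_{\mathrm{mDA}}(M,\{\prec_x,\succ_x\}_{x\in X})$ between the cohomology groups (in degrees $\bullet\ge1$).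
   Context: $\mathbb K$ is a commutative unital ring with $\mathrm{char}\,\mathbb K\neq 2$; all modules, linear maps, Hom spaces and tensor products are over $\mathbb K$; $X$ is a nonempty set. $\cdot$ is the product of $A$ and $\cdot_M$ the actions on the $A$-bimodule $M$. A matching relative Rota-Baxter algebra is a triple $(A,M,\{P_x\}_{x\in X})$ of an associative algebra $A$, an $A$-bimodule $M$ and linear maps $P_x:M\to A$ such that $P_x(u)\cdot P_y(v)=P_x(u\cdot_M P_y(v))+P_y(P_x(u)\cdot_M v)$ for all $u,v\in M$, $x,y\in X$. A matching dendriform algebra is a $\mathbb K$-module $D$ with linear maps $\prec_x,\succ_x:D\otimes D\to D$ such that $(a\prec_xb)\prec_yc=a\prec_x(b\prec_yc)+a\prec_y(b\succ_xc)$, $(a\succ_xb)\prec_yc=a\succ_x(b\prec_yc)$, $(a\prec_yb)\succ_xc+(a\succ_xb)\succ_yc=a\succ_x(b\succ_yc)$ for all $a,b,c\in D$, $x,y\in X$. The complex of $\{P_x\}$: $C^0_{\{P_x\}}(M,A)=A$, and for $n\ge1$, $C^n_{\{P_x\}}(M,A)$ is the $\mathbb K$-module of all families $f=\oplus f_{x_1,\dots,x_n}$, $f_{x_1,\dots,x_n}\in\mathrm{Hom}(M^{\otimes n},A)$, indexed by $X^{\times n}$. For $P\in C^m_{\{P_x\}}(M,A)$, $Q\in C^n_{\{P_x\}}(M,A)$ put $$(P\diamond Q)_{x_1,\dots,x_{m+n}}(u_1,\dots,u_{m+n})=\sum_{i=1}^m(-1)^{(i-1)n}P_{x_1,\dots,x_{i-1},x_{i+n},\dots,x_{m+n}}(u_1,\dots,u_{i-1},Q_{x_i,\dots,x_{i+n-1}}(u_i,\dots,u_{i+n-1})\cdot_M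 u_{i+n},\dots,u_{m+n})$$ $$-\sum_{i=1}^m(-1)^{in}P_{x_1,\dots,x_i,x_{i+n+1},\dots,x_{m+n}}(u_1,\dots,u_{i-1},u_i\cdot_M Q_{x_{i+1},\dots,x_{i+n}}(u_{i+1},\dots,u_{i+n}),u_{i+n+1},\dots,u_{m+n})$$ $$+(-1)^{mn}P_{x_1,\dots,x_m}(u_1,\dots,u_m)\cdot Q_{x_{m+1},\dots,x_{m+n}}(u_{m+1},\dots,u_{m+n}),$$ and $[\![P,Q]\!]=P\diamond Q-(-1)^{mn}Q\diamond P$ (a graded Lie bracket). With $P=\oplus_{x\in X}P_x\in C^1_{\{P_x\}}(M,A)$, the differential is $\delta_{\{P_x\}}(f)=(-1)^n[\![P,f]\!]$ for $f\in C^n_{\{P_x\}}(M,A)$, $n\ge0$, and $H^\bullet_{\{P_x\}}(M,A)$ is its cohomology. The dendriform complex of a matching dendriform algebra $(D,\{\prec_x,\succ_x\})$ (here $D=M$): let $C_k=\{[1],\dots,[k]\}$, $\mathbb K[C_k]$ the free $\mathbb K$-module on it. For $k\ge1$, $C^k_{\mathrm{mDA}}(D,\{\prec_x,\succ_x\})=\mathcal O_D(k)$ is the module of families $f=\oplus_{x_1,\dots,x_k\in X}f_{x_1,\dots,x_k}$, $f_{x_1,\dots,x_k}\in\mathrm{Hom}(\mathbb K[C_k]\otimes D^{\otimes k},D)$, such that $f^{[r]}_{x_1,\dots,x_k}:=f_{x_1,\dots,x_k}([r];-,\dots,-)$ does not depend on $x_r$ for each $r$. For $f\in\mathcal O_D(k)$,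 $g\in\mathcal O_D(l)$, $1\le i\le k$, $(f\circ_ig)^{[r]}_{x_1,\dots,x_{k+l-1}}(a_1,\dots,a_{k+l-1})=$ - if $1\le r\le i-1$: $\sum_{s=1}^lf^{[r]}_{x_1,\dots,x_{i-1},x_{i-1+s},x_{i+l},\dots,x_{k+l-1}}(a_1,\dots,a_{i-1},g^{[s]}_{x_i,\dots,x_{i+l-1}}(a_i,\dots,a_{i+l-1}),a_{i+l},\dots,a_{k+l-1})$; - if $i\le r\le i+l-1$: $f^{[i]}_{x_1,\dots,x_{i-1},x_r,x_{i+l},\dots,x_{k+l-1}}(a_1,\dots,a_{i-1},g^{[r-i+1]}_{x_i,\dots,x_{i+l-1}}(a_i,\dots,a_{i+l-1}),a_{i+l},\dots,a_{k+l-1})$; - if $i+l\le r\le k+l-1$: $\sum_{s=1}^lf^{[r-l+1]}_{x_1,\dots,x_{i-1},x_{i-1+s},x_{i+l},\dots,x_{k+l-1}}(a_1,\dots,a_{i-1},g^{[s]}_{x_i,\dots,x_{i+l-1}}(a_i,\dots,a_{i+l-1}),a_{i+l},\dots,a_{k+l-1})$. The bracket is $\{\!\!\{f,g\}\!\!\}=\sum_{i=1}^k(-1)^{(i-1)(l-1)}f\circ_ig-(-1)^{(k-1)(l-1)}\sum_{i=1}^l(-1)^{(i-1)(k-1)}g\circ_if$, a graded Lie bracket when $\mathcal O_D(k)$ has degree $k-1$. Let $\pi_D\in\mathcal O_D(2)$, $(\pi_D)^{[1]}_{x,y}(a,b)=a\prec_yb$, $(\pi_D)^{[2]}_{x,y}(a,b)=a\succ_xb$.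 The differential is $\delta_{\mathrm{mDA}}(f)=(-1)^{n+1}\{\!\!\{\pi_D,f\}\!\!\}=\pi_D\circ_2f+\sum_{i=1}^n(-1)^if\circ_i\pi_D+(-1)^{n+1}\pi_D\circ_1f$ for $f\in C^n_{\mathrm{mDA}}$, and $H^\bullet_{\mathrm{mDA}}$ is its cohomology (with $C^n_{\mathrm{mDA}}$ starting at $n=1$). *)

theory Defs
  imports
    Complex_Main
    "HOL-Library.Function_Algebras"
    "HOL-Library.Set_Algebras"
begin

section \<open>Matching relative Rota-Baxter algebras and matching dendriform algebras\<close>

text \<open>
  The ground ring is a type of class \<^class>\<open>comm_ring_1\<close>, modules are given by their
  scalar multiplications (locale \<^locale>\<open>module\<close>), and the index set \<open>X\<close> is the type \<open>'x\<close>
  (types are nonempty).  Algebras are associative but not assumed to be unital.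
\<close>

locale associative_algebra = module scaleA
  for scaleA :: "'k::comm_ring_1 \<Rightarrow> 'a::ring \<Rightarrow> 'a" +
  assumes scale_mult_left: "scaleA c a * b = scaleA c (a * b)"
    and scale_mult_right: "a * scaleA c b = scaleA c (a * b)"

locale bimodule = associative_algebra scaleA + M: module scaleM
  for scaleA :: "'k::comm_ring_1 \<Rightarrow> 'a::ring \<Rightarrow> 'a"
    and scaleM :: "'k \<Rightarrow> 'm::ab_group_add \<Rightarrow> 'm" +
  fixes lact :: "'a \<Rightarrow> 'm \<Rightarrow> 'm"
    and ract :: "'m \<Rightarrow> 'a \<Rightarrow> 'm"
  assumes lact_hom_left: "module_hom scaleA scaleM (\<lambda>a. lact a u)"
    and lact_hom_right: "module_hom scaleM scaleM (\<lambda>u. lact a u)"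
    and ract_hom_left: "module_hom scaleM scaleM (\<lambda>u. ract u a)"
    and ract_hom_right: "module_hom scaleA scaleM (\<lambda>a. ract u a)"
    and lact_lact: "lact a (lact b u) = lact (a * b) u"
    and ract_ract: "ract (ract u a) b = ract u (a * b)"
    and lact_ract: "ract (lact a u) b = lact a (ract u b)"

locale matching_relative_rota_baxter = bimodule scaleA scaleM lact ract
  for scaleA :: "'k::comm_ring_1 \<Rightarrow> 'a::ring \<Rightarrow> 'a"
    and scaleM :: "'k \<Rightarrow> 'm::ab_group_add \<Rightarrow> 'm"
    and lact :: "'a \<Rightarrow> 'm \<Rightarrow> 'm"
    and ract :: "'m \<Rightarrow> 'a \<Rightarrow> 'm" +
  fixes P :: "'x \<Rightarrow> 'm \<Rightarrow> 'a"
  assumes P_hom: "module_hom scaleM scaleA (P x)"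
    and rota_baxter: "P x u * P y v = P x (ract u (P y v)) + P y (lact (P x u) v)"

locale matching_dendriform = module scaleD
  for scaleD :: "'k::comm_ring_1 \<Rightarrow> 'd::ab_group_add \<Rightarrow> 'd" +
  fixes prec :: "'x \<Rightarrow> 'd \<Rightarrow> 'd \<Rightarrow> 'd"
    and succ :: "'x \<Rightarrow> 'd \<Rightarrow> 'd \<Rightarrow> 'd"
  assumes prec_hom_left: "module_hom scaleD scaleD (\<lambda>a. prec x a b)"
    and prec_hom_right: "module_hom scaleD scaleD (\<lambda>b. prec x a b)"
    and succ_hom_left: "module_hom scaleD scaleD (\<lambda>a. succ x a b)"
    and succ_hom_right: "module_hom scaleD scaleD (\<lambda>b. succ x a b)"
    and prec_prec: "prec y (prec x a b) c = prec x a (prec y b c) + prec y a (succ x b c)"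
    and succ_prec: "prec y (succ x a b) c = succ x a (prec y b c)"
    and succ_succ: "succ x (prec y a b) c + succ y (succ x a b) c = succ x a (succ y b c)"

definition induced_prec :: "('m \<Rightarrow> 'a \<Rightarrow> 'm) \<Rightarrow> ('x \<Rightarrow> 'm \<Rightarrow> 'a) \<Rightarrow> 'x \<Rightarrow> 'm \<Rightarrow> 'm \<Rightarrow> 'm" where
  "induced_prec ract P x u v = ract u (P x v)"

definition induced_succ :: "('a \<Rightarrow> 'm \<Rightarrow> 'm) \<Rightarrow> ('x \<Rightarrow> 'm \<Rightarrow> 'a) \<Rightarrow> 'x \<Rightarrow> 'm \<Rightarrow> 'm \<Rightarrow> 'm" where
  "induced_succ lact P x u v = lact (P x u) v"

lemma (in matching_relative_rota_baxter) induced_matching_dendriform: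
  "matching_dendriform scaleM (induced_prec ract P) (induced_succ lact P)"
proof -
  note la = module_hom.add[OF lact_hom_left] module_hom.add[OF ract_hom_right]
  have "matching_dendriform_axioms scaleM (induced_prec ract P) (induced_succ lact P)"
  proof (rule matching_dendriform_axioms.intro, unfold induced_prec_def induced_succ_def)
    fix x :: 'x and a b :: 'm
    show "module_hom scaleM scaleM (\<lambda>a. ract a (P x b))" by (rule ract_hom_left)
    show "module_hom scaleM scaleM (\<lambda>b. ract a (P x b))"
      using module_hom_compose[OF P_hom ract_hom_right] by (simp add: comp_def)
    show "module_hom scaleM scaleM (\<lambda>a. lact (P x a) b)"
      using module_hom_compose[OF P_hom lact_hom_left] by (simp add: comp_def)
    show "module_hom scaleM scaleM (\<lambda>b. lact (P x a) b)" by (rule lact_hom_right)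
  next
    fix x y :: 'x and a b c :: 'm
    show "ract (ract a (P x b)) (P y c) = ract a (P x (ract b (P y c))) + ract a (P y (lact (P x b) c))"
      by (simp add: ract_ract rota_baxter la)
    show "ract (lact (P x a) b) (P y c) = lact (P x a) (ract b (P y c))"
      by (rule lact_ract)
    show "lact (P x (ract a (P y b))) c + lact (P y (lact (P x a) b)) c = lact (P x a) (lact (P y b) c)"
      by (simp add: lact_lact rota_baxter la)
  qed
  then show ?thesis
    by (simp add: matching_dendriform_def M.module_axioms)
qed


section \<open>Multilinear maps and families indexed by words\<close>

text \<open>
  Linear maps out of the \<open>n\<close>-fold tensor power are represented by the corresponding multilinear
  maps on lists of length \<open>n\<close>.  Words \<open>x\<^sub>1, \<dots>, x\<^sub>n\<close> of indices are lists too.  All functions are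
  \<open>0\<close> outside their domain of definition, so that equality of functions is equality of
  cochains; for \<open>n = 0\<close> one gets the value at the empty list, i.e. an element of the target.
\<close>

definition multilinear ::
    "('k::comm_ring_1 \<Rightarrow> 'u::ab_group_add \<Rightarrow> 'u) \<Rightarrow> ('k \<Rightarrow> 'v::ab_group_add \<Rightarrow> 'v) \<Rightarrow> nat
      \<Rightarrow> ('u list \<Rightarrow> 'v) \<Rightarrow> bool" where
  "multilinear s s' n f \<longleftrightarrow>
     (\<forall>us. length us \<noteq> n \<longrightarrow> f us = 0) \<and>
     (\<forall>us i. length us = n \<longrightarrow> i < n \<longrightarrow> module_hom s s' (\<lambda>u. f (us[i := u])))"

text \<open>
  Lists are addressed in the \<open>1\<close>-based convention of the formulas: \<open>entry xs j\<close> is \<open>x\<^sub>j\<close>, and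
  \<open>segment xs i j\<close> is \<open>x\<^sub>i, \<dots>, x\<^sub>j\<close>, which is empty if \<open>j < i\<close>.
\<close>

definition entry :: "'a list \<Rightarrow> nat \<Rightarrow> 'a" where
  "entry xs j = xs ! (j - 1)"

definition segment :: "'a list \<Rightarrow> nat \<Rightarrow> nat \<Rightarrow> 'a list" where
  "segment xs i j = take (j + 1 - i) (drop (i - 1) xs)"

text \<open>\<open>signed e v\<close> is \<open>(-1)\<^sup>e v\<close>.\<close>

definition signed :: "nat \<Rightarrow> 'v::group_add \<Rightarrow> 'v" where
  "signed e v = (if even e then v else - v)"


section \<open>The complex of a matching relative Rota-Baxter algebra\<close>

type_synonym ('x, 'm, 'a) rb_cochain = "'x list \<Rightarrow> 'm list \<Rightarrow> 'a"

definition rb_cochains ::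
    "('k::comm_ring_1 \<Rightarrow> 'm::ab_group_add \<Rightarrow> 'm) \<Rightarrow> ('k \<Rightarrow> 'a::ab_group_add \<Rightarrow> 'a) \<Rightarrow> nat
      \<Rightarrow> ('x, 'm, 'a) rb_cochain set" where
  "rb_cochains scaleM scaleA n =
     {f. (\<forall>xs. length xs \<noteq> n \<longrightarrow> f xs = 0) \<and>
         (\<forall>xs. length xs = n \<longrightarrow> multilinear scaleM scaleA n (f xs))}"

definition rb_scale :: "('k \<Rightarrow> 'a \<Rightarrow> 'a) \<Rightarrow> 'k \<Rightarrow> ('x, 'm, 'a) rb_cochain \<Rightarrow> ('x, 'm, 'a) rb_cochain" where
  "rb_scale scaleA c f = (\<lambda>xs us. scaleA c (f xs us))"

definition rb_diamond ::
    "('a::ring \<Rightarrow> 'm \<Rightarrow> 'm) \<Rightarrow> ('m \<Rightarrow> 'a \<Rightarrow> 'm) \<Rightarrow> nat \<Rightarrow> nat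
      \<Rightarrow> ('x, 'm, 'a) rb_cochain \<Rightarrow> ('x, 'm, 'a) rb_cochain \<Rightarrow> ('x, 'm, 'a) rb_cochain" where
  "rb_diamond lact ract m n P Q xs us =
     (if length xs = m + n \<and> length us = m + n then
        (\<Sum>i=1..m. signed ((i - 1) * n)
           (P (segment xs 1 (i - 1) @ segment xs (i + n) (m + n))
              (segment us 1 (i - 1)
                @ [lact (Q (segment xs i (i + n - 1)) (segment us i (i + n - 1))) (entry us (i + n))]
                @ segment us (i + n + 1) (m + n))))
        - (\<Sum>i=1..m. signed (i * n)
           (P (segment xs 1 i @ segment xs (i + n + 1) (m + n))
              (segment us 1 (i - 1)
                @ [ract (entry us i) (Q (segment xs (i + 1) (i + n)) (segment us (i + 1) (i + n)))]
                @ segment us (i + n + 1) (m + n))))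
        + signed (m * n)
           (P (segment xs 1 m) (segment us 1 m)
             * Q (segment xs (m + 1) (m + n)) (segment us (m + 1) (m + n)))
      else 0)"

text \<open>The bracket of a cochain of degree \<open>m\<close> and a cochain of degree \<open>n\<close>.\<close>

definition rb_bracket ::
    "('a::ring \<Rightarrow> 'm \<Rightarrow> 'm) \<Rightarrow> ('m \<Rightarrow> 'a \<Rightarrow> 'm) \<Rightarrow> nat \<Rightarrow> nat
      \<Rightarrow> ('x, 'm, 'a) rb_cochain \<Rightarrow> ('x, 'm, 'a) rb_cochain \<Rightarrow> ('x, 'm, 'a) rb_cochain" where
  "rb_bracket lact ract m n P Q =
     rb_diamond lact ract m n P Q - signed (m * n) (rb_diamond lact ract n m Q P)"

definition rb_element :: "('x \<Rightarrow> 'm \<Rightarrow> 'a::zero) \<Rightarrow> ('x, 'm, 'a) rb_cochain" where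
  "rb_element P xs us =
     (if length xs = 1 \<and> length us = 1 then P (entry xs 1) (entry us 1) else 0)"

definition rb_diff ::
    "('a::ring \<Rightarrow> 'm \<Rightarrow> 'm) \<Rightarrow> ('m \<Rightarrow> 'a \<Rightarrow> 'm) \<Rightarrow> ('x \<Rightarrow> 'm \<Rightarrow> 'a) \<Rightarrow> nat
      \<Rightarrow> ('x, 'm, 'a) rb_cochain \<Rightarrow> ('x, 'm, 'a) rb_cochain" where
  "rb_diff lact ract P n f = signed n (rb_bracket lact ract 1 n (rb_element P) f)"


section \<open>The complex of a matching dendriform algebra\<close>

text \<open>
  A linear map from \<open>K[C\<^sub>k] \<otimes> D \<otimes> \<dots> \<otimes> D\<close> to \<open>D\<close> is given by one multilinear map for each basis
  element \<open>[r]\<close>, so \<open>f xs r as\<close> stands for \<open>f\<close> with index word \<open>xs\<close>, evaluated at \<open>[r]\<close> and \<open>as\<close>.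
\<close>

type_synonym ('x, 'd) mda_cochain = "'x list \<Rightarrow> nat \<Rightarrow> 'd list \<Rightarrow> 'd"

definition mda_cochains ::
    "('k::comm_ring_1 \<Rightarrow> 'd::ab_group_add \<Rightarrow> 'd) \<Rightarrow> nat \<Rightarrow> ('x, 'd) mda_cochain set" where
  "mda_cochains scaleD k =
     {f. (\<forall>xs r. \<not> (length xs = k \<and> r \<in> {1..k}) \<longrightarrow> f xs r = 0) \<and>
         (\<forall>xs r. length xs = k \<longrightarrow> r \<in> {1..k} \<longrightarrow> multilinear scaleD scaleD k (f xs r)) \<and>
         (\<forall>xs r x. length xs = k \<longrightarrow> r \<in> {1..k} \<longrightarrow> f (xs[r - 1 := x]) r = f xs r)}"

definition mda_scale :: "('k \<Rightarrow> 'd \<Rightarrow> 'd) \<Rightarrow> 'k \<Rightarrow> ('x, 'd) mda_cochain \<Rightarrow> ('x, 'd) mda_cochain" where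
  "mda_scale scaleD c f = (\<lambda>xs r as. scaleD c (f xs r as))"

definition mda_comp ::
    "nat \<Rightarrow> nat \<Rightarrow> nat \<Rightarrow> ('x, 'd::ab_group_add) mda_cochain \<Rightarrow> ('x, 'd) mda_cochain
      \<Rightarrow> ('x, 'd) mda_cochain" where
  "mda_comp k l i f g xs r as =
     (if length xs = k + l - 1 \<and> length as = k + l - 1 \<and> r \<in> {1..k + l - 1} then
        let index = (\<lambda>j. segment xs 1 (i - 1) @ [entry xs j] @ segment xs (i + l) (k + l - 1));
            args = (\<lambda>s. segment as 1 (i - 1)
                     @ [g (segment xs i (i + l - 1)) s (segment as i (i + l - 1))]
                     @ segment as (i + l) (k + l - 1))
        in if r \<le> i - 1 then (\<Sum>s=1..l. f (index (i - 1 + s)) r (args s))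
           else if r \<le> i + l - 1 then f (index r) i (args (r - i + 1))
           else (\<Sum>s=1..l. f (index (i - 1 + s)) (r - l + 1) (args s))
      else 0)"

text \<open>The bracket of \<open>f\<close> of arity \<open>k\<close> and \<open>g\<close> of arity \<open>l\<close>, i.e. of degrees \<open>k - 1\<close> and \<open>l - 1\<close>.\<close>

definition mda_bracket ::
    "nat \<Rightarrow> nat \<Rightarrow> ('x, 'd::ab_group_add) mda_cochain \<Rightarrow> ('x, 'd) mda_cochain
      \<Rightarrow> ('x, 'd) mda_cochain" where
  "mda_bracket k l f g =
     (\<Sum>i=1..k. signed ((i - 1) * (l - 1)) (mda_comp k l i f g))
     - signed ((k - 1) * (l - 1)) (\<Sum>i=1..l. signed ((i - 1) * (k - 1)) (mda_comp l k i g f))"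

definition mda_pi ::
    "('x \<Rightarrow> 'd \<Rightarrow> 'd \<Rightarrow> 'd) \<Rightarrow> ('x \<Rightarrow> 'd \<Rightarrow> 'd \<Rightarrow> 'd) \<Rightarrow> ('x, 'd::zero) mda_cochain" where
  "mda_pi prec succ xs r as =
     (if length xs = 2 \<and> length as = 2 \<and> r = 1 then prec (entry xs 2) (entry as 1) (entry as 2)
      else if length xs = 2 \<and> length as = 2 \<and> r = 2 then succ (entry xs 1) (entry as 1) (entry as 2)
      else 0)"

definition mda_diff ::
    "('x \<Rightarrow> 'd \<Rightarrow> 'd \<Rightarrow> 'd) \<Rightarrow> ('x \<Rightarrow> 'd \<Rightarrow> 'd \<Rightarrow> 'd) \<Rightarrow> nat
      \<Rightarrow> ('x, 'd::ab_group_add) mda_cochain \<Rightarrow> ('x, 'd) mda_cochain" where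
  "mda_diff prec succ n f = signed (n + 1) (mda_bracket 2 n (mda_pi prec succ) f)"


section \<open>Cohomology and morphisms\<close>

text \<open>
  A cochain complex is given by subsets \<open>C n\<close> of an ambient additive group and maps
  \<open>d n : C n \<rightarrow> C (n + 1)\<close>; \<open>start\<close> is its lowest degree.  Cohomology classes are the cosets of
  the coboundaries, and cosets are added by the elementwise sum of sets.
\<close>

definition cocycles :: "(nat \<Rightarrow> 'v set) \<Rightarrow> (nat \<Rightarrow> 'v \<Rightarrow> 'v::zero) \<Rightarrow> nat \<Rightarrow> 'v set" where
  "cocycles C d n = {f \<in> C n. d n f = 0}"

definition coboundaries :: "nat \<Rightarrow> (nat \<Rightarrow> 'v set) \<Rightarrow> (nat \<Rightarrow> 'v \<Rightarrow> 'v::zero) \<Rightarrow> nat \<Rightarrow> 'v set" where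
  "coboundaries start C d n = (if n \<le> start then {0} else d (n - 1) ` C (n - 1))"

definition cohomology ::
    "nat \<Rightarrow> (nat \<Rightarrow> 'v set) \<Rightarrow> (nat \<Rightarrow> 'v \<Rightarrow> 'v::ab_group_add) \<Rightarrow> nat \<Rightarrow> 'v set set" where
  "cohomology start C d n = (\<lambda>f. f +o coboundaries start C d n) ` cocycles C d n"

text \<open>
  Scalar multiplication in the quotient by \<open>B\<close>.  Adding \<open>B\<close> is necessary: the image of a coset
  under multiplication by \<open>c\<close> need not be a whole coset, e.g. for \<open>c = 0\<close>.
\<close>

definition coset_scale ::
    "('k \<Rightarrow> 'v \<Rightarrow> 'v::ab_group_add) \<Rightarrow> 'v set \<Rightarrow> 'k \<Rightarrow> 'v set \<Rightarrow> 'v set" where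
  "coset_scale s B c S = s c ` S + B"

definition linear_between ::
    "'v set \<Rightarrow> ('k \<Rightarrow> 'v \<Rightarrow> 'v::plus) \<Rightarrow> 'w set \<Rightarrow> ('k \<Rightarrow> 'w \<Rightarrow> 'w::plus) \<Rightarrow> ('v \<Rightarrow> 'w) \<Rightarrow> bool" where
  "linear_between V s W s' \<phi> \<longleftrightarrow>
     (\<forall>v\<in>V. \<phi> v \<in> W) \<and>
     (\<forall>v\<in>V. \<forall>v'\<in>V. \<phi> (v + v') = \<phi> v + \<phi> v') \<and>
     (\<forall>c. \<forall>v\<in>V. \<phi> (s c v) = s' c (\<phi> v))"

text \<open>
  Morphisms between graded Lie algebras concentrated in degrees \<open>n \<ge> 1\<close>, given by their
  homogeneous components \<open>V n\<close>, \<open>W n\<close> and the brackets of elements of degrees \<open>m\<close> and \<open>n\<close>.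
\<close>

definition graded_lie_morphism ::
    "(nat \<Rightarrow> 'v set) \<Rightarrow> ('k \<Rightarrow> 'v \<Rightarrow> 'v::plus) \<Rightarrow> (nat \<Rightarrow> nat \<Rightarrow> 'v \<Rightarrow> 'v \<Rightarrow> 'v)
      \<Rightarrow> (nat \<Rightarrow> 'w set) \<Rightarrow> ('k \<Rightarrow> 'w \<Rightarrow> 'w::plus) \<Rightarrow> (nat \<Rightarrow> nat \<Rightarrow> 'w \<Rightarrow> 'w \<Rightarrow> 'w)
      \<Rightarrow> (nat \<Rightarrow> 'v \<Rightarrow> 'w) \<Rightarrow> bool" where
  "graded_lie_morphism V s br W s' br' \<phi> \<longleftrightarrow>
     (\<forall>n\<ge>1. linear_between (V n) s (W n) s' (\<phi> n)) \<and>
     (\<forall>m\<ge>1. \<forall>n\<ge>1. \<forall>f\<in>V m. \<forall>g\<in>V n. \<phi> (m + n) (br m n f g) = br' m n (\<phi> m f) (\<phi> n g))"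


section \<open>The maps between the two complexes\<close>

definition theta ::
    "('a \<Rightarrow> 'm \<Rightarrow> 'm) \<Rightarrow> ('m \<Rightarrow> 'a \<Rightarrow> 'm) \<Rightarrow> nat
      \<Rightarrow> ('x, 'm::ab_group_add, 'a) rb_cochain \<Rightarrow> ('x, 'm) mda_cochain" where
  "theta lact ract n f xs r us =
     (if length xs = n + 1 \<and> length us = n + 1 then
        if r = 1 then
          signed (n + 1) (ract (entry us 1) (f (segment xs 2 (n + 1)) (segment us 2 (n + 1))))
        else if r = n + 1 then
          lact (f (segment xs 1 n) (segment us 1 n)) (entry us (n + 1))
        else 0
      else 0)"

end

theory Submission
  imports Defs
begin

text \<open>
  Up to sign, the map \<open>\<theta>\<close> sends a cochain \<open>f\<close> with values in \<open>A\<close> to the sum of its two extensions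
  to an operation on \<open>M\<close>: at \<open>[1]\<close> the value of \<open>f\<close> acts from the right on an extra first argument, and at
  the last basis element it acts from the left on an extra last argument.  The bracket on both
  sides is the graded commutator of a pre-Lie type product, so one compares the two products.

  Inserting \<open>\<theta> g\<close> into the \<open>i\<close>-th argument of \<open>\<theta> f\<close> gives three kinds of terms
  (\<open>mda_comp_ext_theta\<close>).  If the \<open>i\<close>-th argument of \<open>\<theta> f\<close> is an argument of \<open>f\<close>, both extensions of
  \<open>g\<close> are inserted into \<open>f\<close>, which is what happens in \<open>f \<diamond> g\<close>.  If it is the extra argument and
  \<open>g\<close> extends on the same side, two actions are composed and yield the product in \<open>A\<close> of the values
  of \<open>f\<close> and \<open>g\<close>, in the order \<open>f, g\<close> for left actions and \<open>g, f\<close> for right actions.  If \<open>g\<close> extends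
  on the other side, a single argument is acted upon by \<open>f\<close> from one side and by \<open>g\<close> from the other.
  Summing over \<open>i\<close> (\<open>insertion_sum_ext_theta\<close>), the last basis element carries exactly \<open>f \<diamond> g\<close>; the
  first one carries \<open>f \<diamond> g\<close> with its product term \<open>(-1)\<^sup>m\<^sup>n f g\<close> replaced by \<open>- g f\<close>, which has the
  same commutator; and the two-sided terms cancel in the commutator because the left and the right
  action commute.  This is \<open>ext_theta_rb_bracket\<close>.

  Both differentials are, up to sign, brackets with a fixed element, and \<open>\<theta>\<close> maps \<open>P\<close> to \<open>\<pi>\<close>, hence
  \<open>\<theta>\<close> commutes with the differentials (\<open>ext_theta_rb_diff\<close>).  Coboundaries of degree \<open>1\<close> come from
  \<open>C\<^sup>0 = A\<close>, so \<open>\<theta>\<close> is needed in degree \<open>0\<close> as well.  There the first and the last basis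
  element coincide and the correct extension is the sum of the two pieces, \<open>u \<mapsto> a u - u a\<close>.  With
  this convention the computation above holds uniformly for \<open>m, n \<ge> 0\<close>.
\<close>

section \<open>Signs, blocks of lists and multilinear maps\<close>

lemma sum_fun_apply: "sum F I x = (\<Sum>i\<in>I. F i x)"
  by (induction I rule: infinite_finite_induct) simp_all

lemma signed_simps:
  fixes u v :: "'v::ab_group_add"
  shows "signed e 0 = (0::'v)" "signed e (u + v) = signed e u + signed e v"
    "signed e (u - v) = signed e u - signed e v" "signed d (signed e u) = signed (d + e) u"
  by (simp_all add: signed_def)

lemma signed_apply: "signed e F x = signed e (F x :: 'v::ab_group_add)"
  by (simp add: signed_def)

lemma signed_sum: "signed e (\<Sum>i\<in>I. F i) = (\<Sum>i\<in>I. signed e (F i :: 'v::ab_group_add))"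
  by (simp add: signed_def sum_negf)

text \<open>
  All words and argument lists of the partial compositions arise from one list by contracting a block
  of length \<open>l\<close> to a single letter.  The block begins at the \<open>0\<close>-based position \<open>p\<close>, so that positions
  and lengths add without truncated subtraction.
\<close>

definition replace_block :: "'b list \<Rightarrow> nat \<Rightarrow> nat \<Rightarrow> 'b \<Rightarrow> 'b list" where
  "replace_block ws p l v = take p ws @ v # drop (p + l) ws"

lemma length_replace_block: "p + l \<le> length ws \<Longrightarrow> length (replace_block ws p l v) = length ws + 1 - l"
  by (simp add: replace_block_def)

lemma replace_block_Suc:
  assumes "ws \<noteq> []"
  shows "hd (replace_block ws (Suc p) l v) = hd ws"
    "tl (replace_block ws (Suc p) l v) = replace_block (tl ws) p l v"
  using assms by (cases ws; simp add: replace_block_def)+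

lemma replace_block_butlast:
  assumes "p + l < length ws"
  shows "last (replace_block ws p l v) = last ws"
    "butlast (replace_block ws p l v) = replace_block (butlast ws) p l v"
  using assms by (simp_all add: replace_block_def butlast_append take_butlast drop_butlast)

lemma multilinear_replace_block:
  assumes h: "multilinear s s' m h" and len: "length us + 1 = m + l" "p + l \<le> length us"
  shows "module_hom s s' (\<lambda>u. h (replace_block us p l u))"
proof -
  have "length (replace_block us p l v) = m" "p < m" for v
    using len by (simp_all add: length_replace_block)
  then have "module_hom s s' (\<lambda>u. h ((replace_block us p l v)[p := u]))" for v
    using h by (auto simp: multilinear_def)
  moreover have "(replace_block us p l v)[p := u] = replace_block us p l u" for u v
    using len by (simp add: replace_block_def list_update_append)
  ultimately show ?thesis by simp
qed

lemma multilinear_add: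
  assumes "multilinear s s' n f" "multilinear s s' n g"
  shows "multilinear s s' n (f + g)"
  using assms by (auto simp: multilinear_def module_hom_iff module.scale_right_distrib)

lemma multilinear_scale:
  assumes "module s'" "multilinear s s' n f"
  shows "multilinear s s' n (\<lambda>us. s' c (f us))"
  using assms
  by (auto simp: multilinear_def module_hom_iff module.scale_right_distrib module.scale_zero_right
      module.scale_left_commute)

lemma mda_cochains_add:
  assumes "f \<in> mda_cochains s n" "g \<in> mda_cochains s n"
  shows "f + g \<in> mda_cochains s n"
  using assms by (auto simp: mda_cochains_def intro!: multilinear_add)

lemma mda_cochains_scale:
  assumes "module s" "f \<in> mda_cochains s n"
  shows "mda_scale s c f \<in> mda_cochains s n"
  using assms(2)
  by (auto simp: mda_cochains_def mda_scale_def fun_eq_iff module.scale_zero_right[OF assms(1)]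
      intro!: multilinear_scale[OF assms(1)])

section \<open>The comparison map in all degrees\<close>

context bimodule
begin

lemmas act_add = module_hom.add[OF lact_hom_left] module_hom.add[OF lact_hom_right]
  module_hom.add[OF ract_hom_left] module_hom.add[OF ract_hom_right]
lemmas act_diff = module_hom.diff[OF lact_hom_left] module_hom.diff[OF lact_hom_right]
  module_hom.diff[OF ract_hom_left] module_hom.diff[OF ract_hom_right]
lemmas act_zero = module_hom.zero[OF lact_hom_left] module_hom.zero[OF lact_hom_right]
  module_hom.zero[OF ract_hom_left] module_hom.zero[OF ract_hom_right]
lemmas act_neg = module_hom.neg[OF lact_hom_left] module_hom.neg[OF lact_hom_right]
  module_hom.neg[OF ract_hom_left] module_hom.neg[OF ract_hom_right]
lemmas act_sum = module_hom.sum[OF lact_hom_left] module_hom.sum[OF lact_hom_right]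
  module_hom.sum[OF ract_hom_left] module_hom.sum[OF ract_hom_right]
lemmas act_scale = module_hom.scale[OF lact_hom_left] module_hom.scale[OF lact_hom_right]
  module_hom.scale[OF ract_hom_left] module_hom.scale[OF ract_hom_right]

lemma act_signed:
  "lact (signed e a) u = signed e (lact a u)" "lact a (signed e u) = signed e (lact a u)"
  "ract (signed e u) a = signed e (ract u a)" "ract u (signed e a) = signed e (ract u a)"
  by (simp_all add: signed_def act_neg)

text \<open>
  The two pieces are added instead of selected by cases.  This changes only degree \<open>0\<close>, where
  \<open>r = 1\<close> is both the first and the last basis element and the value is \<open>a u - u a\<close>.
\<close>

definition ext_theta :: "nat \<Rightarrow> ('x, 'm, 'a) rb_cochain \<Rightarrow> ('x, 'm) mda_cochain" where
  "ext_theta n f xs r us =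
     (if length xs = Suc n \<and> length us = Suc n then
        (if r = 1 then signed (Suc n) (ract (hd us) (f (tl xs) (tl us))) else 0)
        + (if r = Suc n then lact (f (butlast xs) (butlast us)) (last us) else 0)
      else 0)"

lemma theta_eq_ext_theta:
  assumes "1 \<le> n"
  shows "theta lact ract n f = ext_theta n f"
proof (intro ext)
  fix xs r us
  show "theta lact ract n f xs r us = ext_theta n f xs r us"
  proof (cases "length xs = Suc n \<and> length us = Suc n")
    case True
    then have "xs \<noteq> []" "us \<noteq> []" by auto
    with True have "segment xs 2 (n + 1) = tl xs" "segment us 2 (n + 1) = tl us"
      "segment xs 1 n = butlast xs" "segment us 1 n = butlast us"
      "entry us 1 = hd us" "entry us (n + 1) = last us"
      by (auto simp: segment_def entry_def butlast_conv_take drop_Suc hd_conv_nth last_conv_nth)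
    with True assms show ?thesis
      unfolding theta_def ext_theta_def by auto
  qed (auto simp: theta_def ext_theta_def)
qed

text \<open>
  The part of \<open>f \<diamond> g\<close> in which \<open>g\<close> enters \<open>f\<close> together with a neighbouring argument.  Written with
  the extension of \<open>g\<close>, this is the sum over \<open>[s]\<close> that defines the partial composition when the basis
  element is not in the block, where the index word keeps the letter at position \<open>s\<close> of the block.
\<close>

definition graft ::
    "nat \<Rightarrow> ('x, 'm, 'a) rb_cochain \<Rightarrow> ('x, 'm, 'a) rb_cochain \<Rightarrow> nat
      \<Rightarrow> 'x list \<Rightarrow> 'm list \<Rightarrow> 'a" where
  "graft n f g p xs us =
     (\<Sum>s<Suc n. f (replace_block xs p (Suc n) (xs ! (p + s)))
        (replace_block us p (Suc n)
          (ext_theta n g (take (Suc n) (drop p xs)) (Suc s) (take (Suc n) (drop p us)))))"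

lemma ext_theta_block:
  assumes "length xs = length us" "p + n < length us"
  shows "ext_theta n g (take (Suc n) (drop p xs)) (Suc s) (take (Suc n) (drop p us)) =
      (if s = 0 then signed (Suc n)
           (ract (us ! p) (g (take n (drop (Suc p) xs)) (take n (drop (Suc p) us)))) else 0)
        + (if s = n then lact (g (take n (drop p xs)) (take n (drop p us))) (us ! (p + n)) else 0)"
proof -
  have "hd (take (Suc n) (drop p us)) = us ! p" "last (take (Suc n) (drop p us)) = us ! (p + n)"
    using assms by (simp_all add: hd_drop_conv_nth last_conv_nth)
  moreover have "tl (take (Suc n) (drop p xs)) = take n (drop (Suc p) xs)"
    "tl (take (Suc n) (drop p us)) = take n (drop (Suc p) us)"
    by (simp_all add: tl_take tl_drop drop_Suc)
  moreover have "butlast (take (Suc n) (drop p xs)) = take n (drop p xs)"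
    "butlast (take (Suc n) (drop p us)) = take n (drop p us)"
    using assms by (simp_all add: butlast_take)
  moreover have "length (take (Suc n) (drop p xs)) = Suc n" "length (take (Suc n) (drop p us)) = Suc n"
    using assms by simp_all
  ultimately show ?thesis
    by (simp only: ext_theta_def) simp
qed

text \<open>
  The summands for \<open>[1]\<close> and \<open>[n + 1]\<close> are the right and the left action of \<open>g\<close>, and they keep the
  letters \<open>x\<^sub>i\<close> and \<open>x\<^sub>i\<^sub>+\<^sub>n\<close>: these are the two families of terms of \<open>f \<diamond> g\<close>.  Adding the cases
  first and separating them by multilinearity of \<open>f\<close> includes \<open>n = 0\<close>, where both occur at \<open>s = 0\<close>.
\<close>

lemma graft_expand:
  assumes f: "f \<in> rb_cochains scaleM scaleA m" and "p < m" "length xs = m + n" "length us = m + n"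
  shows "graft n f g p xs us =
     f (replace_block xs p (Suc n) (xs ! (p + n)))
       (replace_block us p (Suc n) (lact (g (take n (drop p xs)) (take n (drop p us))) (us ! (p + n))))
     + signed (Suc n) (f (replace_block xs p (Suc n) (xs ! p))
       (replace_block us p (Suc n)
         (ract (us ! p) (g (take n (drop (Suc p) xs)) (take n (drop (Suc p) us))))))"
proof -
  have hom: "module_hom scaleM scaleA
      (\<lambda>u. f (replace_block xs p (Suc n) x) (replace_block us p (Suc n) u))" for x
    using assms by (intro multilinear_replace_block[where m = m])
      (simp_all add: rb_cochains_def length_replace_block)
  have if_hom: "f (replace_block xs p (Suc n) x) (replace_block us p (Suc n) (if b then u else 0)) =
      (if b then f (replace_block xs p (Suc n) x) (replace_block us p (Suc n) u) else 0)" for x b u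
    by (simp add: module_hom.zero[OF hom])
  have signed_hom: "f (replace_block xs p (Suc n) x) (replace_block us p (Suc n) (signed e u)) =
      signed e (f (replace_block xs p (Suc n) x) (replace_block us p (Suc n) u))" for x e u
    by (simp add: signed_def module_hom.neg[OF hom])
  have block: "ext_theta n g (take (Suc n) (drop p xs)) (Suc s) (take (Suc n) (drop p us)) =
      (if s = 0 then signed (Suc n)
           (ract (us ! p) (g (take n (drop (Suc p) xs)) (take n (drop (Suc p) us)))) else 0)
        + (if s = n then lact (g (take n (drop p xs)) (take n (drop p us))) (us ! (p + n)) else 0)" for s
    using assms by (intro ext_theta_block) simp_all
  show ?thesis
    unfolding graft_def block
    by (simp add: module_hom.add[OF hom] if_hom signed_hom sum.distrib sum.delta del: sum.lessThan_Suc)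
qed

definition cup :: "nat \<Rightarrow> ('x, 'm, 'a) rb_cochain \<Rightarrow> ('x, 'm, 'a) rb_cochain
      \<Rightarrow> 'x list \<Rightarrow> 'm list \<Rightarrow> 'a" where
  "cup m f g xs us = f (take m xs) (take m us) * g (drop m xs) (drop m us)"

lemma rb_diamond_eq_graft:
  assumes f: "f \<in> rb_cochains scaleM scaleA m" and len: "length xs = m + n" "length us = m + n"
  shows "rb_diamond lact ract m n f g xs us =
    (\<Sum>p<m. signed (p * n) (graft n f g p xs us)) + signed (m * n) (cup m f g xs us)"
proof -
  define L where "L p = f (replace_block xs p (Suc n) (xs ! (p + n)))
       (replace_block us p (Suc n) (lact (g (take n (drop p xs)) (take n (drop p us))) (us ! (p + n))))" for p
  define R where "R p = f (replace_block xs p (Suc n) (xs ! p))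
       (replace_block us p (Suc n)
         (ract (us ! p) (g (take n (drop (Suc p) xs)) (take n (drop (Suc p) us)))))" for p
  have L: "f (segment xs 1 (i - 1) @ segment xs (i + n) (m + n))
              (segment us 1 (i - 1)
                @ [lact (g (segment xs i (i + n - 1)) (segment us i (i + n - 1))) (entry us (i + n))]
                @ segment us (i + n + 1) (m + n)) = L (i - 1)"
    and R: "f (segment xs 1 i @ segment xs (i + n + 1) (m + n))
              (segment us 1 (i - 1)
                @ [ract (entry us i) (g (segment xs (i + 1) (i + n)) (segment us (i + 1) (i + n)))]
                @ segment us (i + n + 1) (m + n)) = R (i - 1)"
    if i: "i \<in> {1..m}" for i
  proof -
    obtain p where p: "i = Suc p" "p < m" using i by (cases i) auto
    have seg: "segment ws (p + 1) (p + n) = take n (drop p ws)"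
      "segment ws (p + 2) (p + n + 1) = take n (drop (Suc p) ws)"
      "segment ws 1 p = take p ws" for ws :: "'z list"
      by (simp_all add: segment_def)
    have us: "segment us (p + n + 2) (m + n) = drop (p + Suc n) us"
      using p len by (simp add: segment_def)
    have L: "segment xs (p + n + 1) (m + n) = xs ! (p + n) # drop (p + Suc n) xs"
      using p len Cons_nth_drop_Suc[of "p + n" xs] by (simp add: segment_def)
    have R: "segment xs 1 (p + 1) = take p xs @ [xs ! p]"
      "segment xs (p + n + 2) (m + n) = drop (p + Suc n) xs"
      using p len by (simp_all add: segment_def take_Suc_conv_app_nth)
    show "f (segment xs 1 (i - 1) @ segment xs (i + n) (m + n))
              (segment us 1 (i - 1)
                @ [lact (g (segment xs i (i + n - 1)) (segment us i (i + n - 1))) (entry us (i + n))]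
                @ segment us (i + n + 1) (m + n)) = L (i - 1)"
      using L us seg[of xs] seg[of us] by (simp add: p(1) L_def replace_block_def entry_def)
    show "f (segment xs 1 i @ segment xs (i + n + 1) (m + n))
              (segment us 1 (i - 1)
                @ [ract (entry us i) (g (segment xs (i + 1) (i + n)) (segment us (i + 1) (i + n)))]
                @ segment us (i + n + 1) (m + n)) = R (i - 1)"
      using R us seg[of xs] seg[of us] by (simp add: p(1) R_def replace_block_def entry_def)
  qed
  have cup: "f (segment xs 1 m) (segment us 1 m)
             * g (segment xs (m + 1) (m + n)) (segment us (m + 1) (m + n)) = cup m f g xs us"
    using len by (simp add: cup_def segment_def)
  have "rb_diamond lact ract m n f g xs us =
      (\<Sum>i=1..m. signed ((i - 1) * n) (L (i - 1))) - (\<Sum>i=1..m. signed (i * n) (R (i - 1)))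
      + signed (m * n) (cup m f g xs us)"
    unfolding rb_diamond_def cup using len by (simp only: L R simp_thms if_True cong: sum.cong)
  also have "(\<Sum>i=1..m. signed ((i - 1) * n) (L (i - 1))) = (\<Sum>p<m. signed (p * n) (L p))"
    by (rule sum.reindex_bij_witness[of _ Suc "\<lambda>i. i - 1"]) auto
  also have "(\<Sum>i=1..m. signed (i * n) (R (i - 1))) = (\<Sum>p<m. signed (Suc p * n) (R p))"
    by (rule sum.reindex_bij_witness[of _ Suc "\<lambda>i. i - 1"]) auto
  also have "(\<Sum>p<m. signed (p * n) (L p)) - (\<Sum>p<m. signed (Suc p * n) (R p)) =
      (\<Sum>p<m. signed (p * n) (graft n f g p xs us))"
    unfolding sum_subtractf[symmetric]
  proof (rule sum.cong)
    fix p assume "p \<in> {..<m}"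
    then have "graft n f g p xs us = L p + signed (Suc n) (R p)"
      unfolding L_def R_def by (intro graft_expand[OF f _ len]) simp
    then show "signed (p * n) (L p) - signed (Suc p * n) (R p) = signed (p * n) (graft n f g p xs us)"
      by (auto simp: signed_def)
  qed simp
  finally show ?thesis .
qed

section \<open>Partial compositions of extended cochains\<close>

lemma mda_comp_replace_block:
  assumes len: "length xs = Suc (m + n)" "length us = Suc (m + n)" and r: "1 \<le> r" "r \<le> Suc (m + n)"
    and p: "p \<le> m"
  shows "mda_comp (Suc m) (Suc n) (Suc p) F G xs r us =
    (let args = \<lambda>s. replace_block us p (Suc n) (G (take (Suc n) (drop p xs)) s (take (Suc n) (drop p us)));
         index = \<lambda>j. replace_block xs p (Suc n) (xs ! j)
     in if r \<le> p then (\<Sum>s<Suc n. F (index (p + s)) r (args (Suc s)))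
        else if r \<le> Suc (p + n) then F (index (r - 1)) (Suc p) (args (r - p))
        else (\<Sum>s<Suc n. F (index (p + s)) (r - n) (args (Suc s))))"
proof -
  define H where "H q j s = F (replace_block xs p (Suc n) (xs ! j)) q
    (replace_block us p (Suc n) (G (take (Suc n) (drop p xs)) s (take (Suc n) (drop p us))))" for q j s
  have words: "segment xs 1 (Suc p - 1) @ [v] @ segment xs (Suc p + Suc n) (Suc m + Suc n - 1) =
      replace_block xs p (Suc n) v"
    "segment us 1 (Suc p - 1) @ [w] @ segment us (Suc p + Suc n) (Suc m + Suc n - 1) =
      replace_block us p (Suc n) w"
    "segment xs (Suc p) (Suc p + Suc n - 1) = take (Suc n) (drop p xs)"
    "segment us (Suc p) (Suc p + Suc n - 1) = take (Suc n) (drop p us)" for v w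
    using len p by (simp_all add: segment_def replace_block_def)
  have reindex: "(\<Sum>s = 1..Suc n. H q (Suc p - 1 + s - 1) s) = (\<Sum>s<Suc n. H q (p + s) (Suc s))" for q
    by (rule sum.reindex_bij_witness[of _ Suc "\<lambda>i. i - 1"]) auto
  have "mda_comp (Suc m) (Suc n) (Suc p) F G xs r us =
      (if r \<le> Suc p - 1 then \<Sum>s = 1..Suc n. H r (Suc p - 1 + s - 1) s
       else if r \<le> Suc p + Suc n - 1 then H (Suc p) (r - 1) (r - Suc p + 1)
       else \<Sum>s = 1..Suc n. H (r - Suc n + 1) (Suc p - 1 + s - 1) s)"
    unfolding mda_comp_def Let_def entry_def words H_def using r len by simp
  moreover have "r - Suc p + 1 = r - p" if "p < r"
    using that by auto
  moreover have "r - Suc n + 1 = r - n" if "n < r"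
    using that by auto
  ultimately show ?thesis
    unfolding Let_def H_def[symmetric] reindex by auto
qed

text \<open>The two-sided terms, in which the argument between those of \<open>f\<close> and those of \<open>g\<close> is acted upon by both.\<close>

definition sandwich :: "nat \<Rightarrow> ('x, 'm, 'a) rb_cochain \<Rightarrow> ('x, 'm, 'a) rb_cochain
      \<Rightarrow> 'x list \<Rightarrow> 'm list \<Rightarrow> 'm" where
  "sandwich m f g xs us =
     lact (f (take m xs) (take m us)) (ract (us ! m) (g (drop (Suc m) xs) (drop (Suc m) us)))"

text \<open>
  An extended cochain vanishes away from the first and the last basis element.  Outside the block
  this leaves only \<open>r = 1\<close> to the left of it and \<open>r = m + n + 1\<close> to the right of it, where the extra
  argument of \<open>f\<close> is untouched.  Inside the block the outer operation sits at \<open>[p + 1]\<close>, hence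
  \<open>p = 0\<close> or \<open>p = m\<close>, and the block becomes the extra argument of \<open>f\<close>.
\<close>

lemma mda_comp_ext_theta:
  assumes f: "f \<in> rb_cochains scaleM scaleA m"
    and len: "length xs = Suc (m + n)" "length us = Suc (m + n)" and r: "1 \<le> r" "r \<le> Suc (m + n)"
    and p: "p \<le> m"
  shows "mda_comp (Suc m) (Suc n) (Suc p) (ext_theta m f) (ext_theta n g) xs r us =
      (if r = 1 \<and> 0 < p
       then signed (Suc m) (ract (hd us) (graft n f g (p - 1) (tl xs) (tl us))) else 0)
      + (if r = Suc (m + n) \<and> p < m
         then lact (graft n f g p (butlast xs) (butlast us)) (last us) else 0)
      + (if r = 1 \<and> p = 0
         then signed (m + n) (ract (hd us) (cup n g f (tl xs) (tl us))) else 0)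
      + (if r = Suc (m + n) \<and> p = m
         then lact (cup m f g (butlast xs) (butlast us)) (last us) else 0)
      + (if r = Suc n \<and> p = 0
         then signed (Suc m) (sandwich n g f xs us) else 0)
      + (if r = Suc m \<and> p = m
         then signed (Suc n) (sandwich m f g xs us) else 0)"
proof -
  define G where "G s = ext_theta n g (take (Suc n) (drop p xs)) s (take (Suc n) (drop p us))" for s
  have ne: "xs \<noteq> []" "us \<noteq> []" using len by auto
  \<comment> \<open>The block lies to the right of \<open>r\<close>, inside the arguments of \<open>f\<close>, and the first argument is split off.\<close>
  have head: "(\<Sum>s<Suc n. ext_theta m f (replace_block xs p (Suc n) (xs ! (p + s))) r
         (replace_block us p (Suc n) (G (Suc s)))) =
      (if r = 1 then signed (Suc m) (ract (hd us) (graft n f g (p - 1) (tl xs) (tl us))) else 0)"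
    if rp: "r \<le> p"
  proof -
    obtain q where q: "p = Suc q" using rp r by (cases p) auto
    have "ext_theta m f (replace_block xs p (Suc n) (xs ! (p + s))) r
         (replace_block us p (Suc n) (G (Suc s))) =
      (if r = 1 then signed (Suc m) (ract (hd us)
         (f (replace_block (tl xs) q (Suc n) (tl xs ! (q + s)))
            (replace_block (tl us) q (Suc n) (G (Suc s))))) else 0)" if "s < Suc n" for s
      using that rp len p ne
      by (simp add: ext_theta_def q replace_block_Suc length_replace_block nth_tl)
    then show ?thesis
      by (simp add: q graft_def G_def drop_Suc act_sum signed_sum del: sum.lessThan_Suc)
  qed
  \<comment> \<open>The block lies to the left of \<open>r\<close>, inside the arguments of \<open>f\<close>, and the last argument is split off.\<close>
  have tail: "(\<Sum>s<Suc n. ext_theta m f (replace_block xs p (Suc n) (xs ! (p + s))) (r - n)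
         (replace_block us p (Suc n) (G (Suc s)))) =
      (if r = Suc (m + n) then lact (graft n f g p (butlast xs) (butlast us)) (last us) else 0)"
    if "Suc (p + n) < r"
  proof -
    have rs: "r - n \<noteq> 1" "p < m" "r - n = Suc m \<longleftrightarrow> r = Suc (m + n)" using that r by auto
    have "ext_theta m f (replace_block xs p (Suc n) (xs ! (p + s))) (r - n)
         (replace_block us p (Suc n) (G (Suc s))) =
      (if r = Suc (m + n) then lact
         (f (replace_block (butlast xs) p (Suc n) (butlast xs ! (p + s)))
            (replace_block (butlast us) p (Suc n) (G (Suc s)))) (last us) else 0)" if "s < Suc n" for s
      using that rs len
      by (simp add: ext_theta_def replace_block_butlast length_replace_block nth_butlast)
    moreover have "take (Suc n) (drop p (butlast xs)) = take (Suc n) (drop p xs)"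
      "take (Suc n) (drop p (butlast us)) = take (Suc n) (drop p us)"
      using rs len by (simp_all add: butlast_conv_take drop_take)
    ultimately show ?thesis
      by (simp add: graft_def G_def act_sum del: sum.lessThan_Suc)
  qed
  have middle: "ext_theta m f (replace_block xs p (Suc n) (xs ! (r - 1))) (Suc p)
         (replace_block us p (Suc n) (G (r - p))) =
      (if r = 1 \<and> p = 0
       then signed (m + n) (ract (hd us) (cup n g f (tl xs) (tl us))) else 0)
      + (if r = Suc (m + n) \<and> p = m
         then lact (cup m f g (butlast xs) (butlast us)) (last us) else 0)
      + (if r = Suc n \<and> p = 0
         then signed (Suc m) (sandwich n g f xs us) else 0)
      + (if r = Suc m \<and> p = m
         then signed (Suc n) (sandwich m f g xs us) else 0)"
    if rp: "p < r" "r \<le> Suc (p + n)"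
  proof -
    obtain s where s: "r = Suc (p + s)" using rp less_iff_Suc_add by auto
    have G: "G (r - p) = (if s = 0 then signed (Suc n)
           (ract (us ! p) (g (take n (drop (Suc p) xs)) (take n (drop (Suc p) us)))) else 0)
        + (if s = n then lact (g (take n (drop p xs)) (take n (drop p us))) (us ! (p + n)) else 0)"
      using ext_theta_block[of xs us p n g s] len p by (simp add: G_def s)
    \<comment> \<open>\<open>A\<close> and \<open>B\<close> are the right and left actions of \<open>f\<close> on the value of the block; both occur if \<open>m = 0\<close>.\<close>
    define A B where "A = signed (Suc m) (ract (G (r - p)) (f (drop (Suc n) xs) (drop (Suc n) us)))"
      and "B = lact (f (take m xs) (take m us)) (G (r - p))"
    have left: "A =
        (if r = 1 then signed (m + n) (ract (hd us) (cup n g f (tl xs) (tl us))) else 0)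
        + (if r = Suc n then signed (Suc m) (sandwich n g f xs us) else 0)" if "p = 0"
      using that ne unfolding A_def G cup_def
      by (simp add: s sandwich_def lact_ract drop_Suc hd_conv_nth act_add act_zero act_signed
          signed_simps ract_ract)
        (simp add: signed_def)
    have right: "B =
        (if r = Suc (m + n) then lact (cup m f g (butlast xs) (butlast us)) (last us) else 0)
        + (if r = Suc m then signed (Suc n) (sandwich m f g xs us) else 0)" if "p = m"
    proof -
      have "take m (butlast xs) = take m xs" "take m (butlast us) = take m us"
        "drop m (butlast xs) = take n (drop m xs)" "drop m (butlast us) = take n (drop m us)"
        "last us = us ! (m + n)"
        using ne len by (simp_all add: butlast_conv_take drop_take last_conv_nth)
      then show ?thesis
        using that len unfolding B_def G cup_def
        by (simp add: s sandwich_def act_add act_zero act_signed lact_lact)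
    qed
    have "ext_theta m f (replace_block xs p (Suc n) (xs ! (r - 1))) (Suc p)
         (replace_block us p (Suc n) (G (r - p))) =
      (if p = 0 then A else 0) + (if p = m then B else 0)"
      using len p unfolding A_def B_def
      by (simp add: ext_theta_def length_replace_block)
        (simp add: replace_block_def butlast_append)
    then show ?thesis
      using left right by (cases "p = 0"; cases "p = m") simp_all
  qed
  show ?thesis
    unfolding mda_comp_replace_block[OF len r p] Let_def G_def[symmetric]
    using head middle tail r p by (cases "r \<le> p"; cases "r \<le> Suc (p + n)") auto
qed

section \<open>Compatibility with the brackets\<close>

text \<open>
  At \<open>r = 1\<close> the insertions into arguments of \<open>f\<close> start at the second position, so their sum carries an
  additional factor \<open>(-1)\<^sup>n\<close>, which together with the sign of the extension of \<open>f\<close> is the sign of an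
  extension of degree \<open>m + n\<close>.  The product of \<open>A\<close> arises here from the insertion at the first
  position, as \<open>(u g) f = u (g f)\<close>, and with the opposite sign.
\<close>

lemma insertion_sum_ext_theta:
  assumes f: "f \<in> rb_cochains scaleM scaleA m"
    and len: "length xs = Suc (m + n)" "length us = Suc (m + n)" and r: "1 \<le> r" "r \<le> Suc (m + n)"
  shows "(\<Sum>i = 1..m + 1. signed ((i - 1) * n)
        (mda_comp (m + 1) (n + 1) i (ext_theta m f) (ext_theta n g) xs r us)) =
      (if r = 1 then signed (Suc (m + n)) (ract (hd us)
         (rb_diamond lact ract m n f g (tl xs) (tl us)
          - signed (m * n) (cup m f g (tl xs) (tl us)) - cup n g f (tl xs) (tl us))) else 0)
      + (if r = Suc (m + n)
         then lact (rb_diamond lact ract m n f g (butlast xs) (butlast us)) (last us) else 0)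
      + (if r = Suc n then signed (Suc m) (sandwich n g f xs us) else 0)
      + (if r = Suc m then signed (m * n + Suc n) (sandwich m f g xs us) else 0)"
proof -
  have diamond_tl: "rb_diamond lact ract m n f g (tl xs) (tl us) =
    (\<Sum>p<m. signed (p * n) (graft n f g p (tl xs) (tl us))) + signed (m * n) (cup m f g (tl xs) (tl us))"
    using len by (intro rb_diamond_eq_graft[OF f]) simp_all
  have diamond_butlast: "rb_diamond lact ract m n f g (butlast xs) (butlast us) =
    (\<Sum>p<m. signed (p * n) (graft n f g p (butlast xs) (butlast us)))
      + signed (m * n) (cup m f g (butlast xs) (butlast us))"
    using len by (intro rb_diamond_eq_graft[OF f]) simp_all
  define A where "A p = ract (hd us) (graft n f g p (tl xs) (tl us))" for p
  define B where "B p = lact (graft n f g p (butlast xs) (butlast us)) (last us)" for p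
  define C where "C = ract (hd us) (cup n g f (tl xs) (tl us))"
  define D where "D = lact (cup m f g (butlast xs) (butlast us)) (last us)"
  have "(\<Sum>i = 1..m + 1. signed ((i - 1) * n)
        (mda_comp (m + 1) (n + 1) i (ext_theta m f) (ext_theta n g) xs r us)) =
      (\<Sum>p<Suc m. signed (p * n)
        (mda_comp (Suc m) (Suc n) (Suc p) (ext_theta m f) (ext_theta n g) xs r us))"
    by (rule sum.reindex_bij_witness[of _ Suc "\<lambda>i. i - 1"]) auto
  also have "\<dots> = (\<Sum>p<Suc m. signed (p * n)
      ((if r = 1 \<and> 0 < p then signed (Suc m) (A (p - 1)) else 0)
      + (if r = Suc (m + n) \<and> p < m then B p else 0)
      + (if r = 1 \<and> p = 0 then signed (m + n) C else 0)
      + (if r = Suc (m + n) \<and> p = m then D else 0)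
      + (if r = Suc n \<and> p = 0 then signed (Suc m) (sandwich n g f xs us) else 0)
      + (if r = Suc m \<and> p = m then signed (Suc n) (sandwich m f g xs us) else 0)))"
    by (intro sum.cong refl)
      (simp add: mda_comp_ext_theta[OF f len r] A_def B_def C_def D_def)
  also have "\<dots> =
      (if r = 1 then (\<Sum>p<m. signed (Suc p * n + Suc m) (A p)) + signed (m + n) C else 0)
      + (if r = Suc (m + n) then (\<Sum>p<m. signed (p * n) (B p)) + signed (m * n) D else 0)
      + (if r = Suc n then signed (Suc m) (sandwich n g f xs us) else 0)
      + (if r = Suc m then signed (m * n + Suc n) (sandwich m f g xs us) else 0)"
  proof -
    have "(\<Sum>p<Suc m. signed (p * n) (if r = 1 \<and> 0 < p then signed (Suc m) (A (p - 1)) else 0)) =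
        (if r = 1 then \<Sum>p<m. signed (Suc p * n + Suc m) (A p) else 0)"
      by (simp add: sum.lessThan_Suc_shift signed_simps del: sum.lessThan_Suc)
    moreover have "(\<Sum>p<Suc m. signed (p * n) (if r = Suc (m + n) \<and> p < m then B p else 0)) =
        (if r = Suc (m + n) then \<Sum>p<m. signed (p * n) (B p) else 0)"
      by (simp add: signed_simps)
    moreover have at: "(\<Sum>p<Suc m. signed (p * n) (if b \<and> p = q then v else 0)) =
        (if b then signed (q * n) v else 0)" if "q \<le> m" for b q and v :: 'm
    proof -
      have "signed (p * n) (if b \<and> p = q then v else 0) = (if p = q then if b then signed (q * n) v else 0 else 0)"
        for p by (simp add: signed_simps)
      then show ?thesis using that by (simp add: sum.delta del: sum.lessThan_Suc)
    qed
    ultimately show ?thesis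
      by (simp add: signed_simps(2) sum.distrib del: sum.lessThan_Suc)
        (simp add: signed_simps)
  qed
  also have "(\<Sum>p<m. signed (Suc p * n + Suc m) (A p)) + signed (m + n) C =
      signed (Suc (m + n)) (ract (hd us)
         (rb_diamond lact ract m n f g (tl xs) (tl us)
          - signed (m * n) (cup m f g (tl xs) (tl us)) - cup n g f (tl xs) (tl us)))"
  proof -
    have "signed (Suc p * n + Suc m) (A p) = signed (Suc (m + n)) (signed (p * n) (A p))" for p
      by (simp add: signed_simps signed_def)
    then show ?thesis
      unfolding diamond_tl A_def C_def
      by (simp add: act_diff act_sum act_signed signed_simps(3) signed_sum[symmetric])
        (simp add: signed_def)
  qed
  also have "(\<Sum>p<m. signed (p * n) (B p)) + signed (m * n) D =
      lact (rb_diamond lact ract m n f g (butlast xs) (butlast us)) (last us)"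
    unfolding diamond_butlast B_def D_def by (simp add: act_add act_sum act_signed)
  finally show ?thesis .
qed

text \<open>
  After antisymmetrization the product terms at \<open>r = 1\<close> agree with those of the bracket, and the
  two-sided terms at \<open>r = m + 1\<close> and \<open>r = n + 1\<close> of one composition cancel those of the other.
\<close>

lemma ext_theta_rb_bracket:
  fixes f g :: "('x, 'm, 'a) rb_cochain"
  assumes f: "f \<in> rb_cochains scaleM scaleA m" and g: "g \<in> rb_cochains scaleM scaleA n"
  shows "ext_theta (m + n) (rb_bracket lact ract m n f g) =
    mda_bracket (m + 1) (n + 1) (ext_theta m f) (ext_theta n g)"
proof (intro ext)
  fix xs :: "'x list" and r :: nat and us :: "'m list"
  have bracket: "mda_bracket (m + 1) (n + 1) F G xs r us =
      (\<Sum>i = 1..m + 1. signed ((i - 1) * n) (mda_comp (m + 1) (n + 1) i F G xs r us))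
      - signed (m * n) (\<Sum>i = 1..n + 1. signed ((i - 1) * m) (mda_comp (n + 1) (m + 1) i G F xs r us))"
    for F G :: "('x, 'm) mda_cochain"
    by (simp add: mda_bracket_def sum_fun_apply signed_apply)
  show "ext_theta (m + n) (rb_bracket lact ract m n f g) xs r us =
    mda_bracket (m + 1) (n + 1) (ext_theta m f) (ext_theta n g) xs r us"
  proof (cases "length xs = Suc (m + n) \<and> length us = Suc (m + n) \<and> 1 \<le> r \<and> r \<le> Suc (m + n)")
    case True
    then have len: "length xs = Suc (m + n)" "length us = Suc (m + n)"
      and len': "length xs = Suc (n + m)" "length us = Suc (n + m)"
      and r: "1 \<le> r" "r \<le> Suc (m + n)" and r': "r \<le> Suc (n + m)" by auto
    \<comment> \<open>\<open>X\<close>, \<open>Y\<close> and \<open>T\<close> are the terms at \<open>[1]\<close>, the terms at \<open>[m + n + 1]\<close> and the two-sided terms.\<close>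
    define X1 X2 where
      "X1 = signed (Suc (m + n)) (ract (hd us) (rb_diamond lact ract m n f g (tl xs) (tl us)
          - signed (m * n) (cup m f g (tl xs) (tl us)) - cup n g f (tl xs) (tl us)))"
      and "X2 = signed (Suc (m + n)) (ract (hd us) (rb_diamond lact ract n m g f (tl xs) (tl us)
          - signed (n * m) (cup n g f (tl xs) (tl us)) - cup m f g (tl xs) (tl us)))"
    define Y1 Y2 where
      "Y1 = lact (rb_diamond lact ract m n f g (butlast xs) (butlast us)) (last us)"
      and "Y2 = lact (rb_diamond lact ract n m g f (butlast xs) (butlast us)) (last us)"
    define S1 S2 where "S1 = sandwich m f g xs us" and "S2 = sandwich n g f xs us"
    have first: "signed (Suc (m + n)) (ract (hd us) (rb_bracket lact ract m n f g (tl xs) (tl us))) =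
        X1 - signed (m * n) X2"
      unfolding X1_def X2_def rb_bracket_def
      by (simp add: signed_apply act_diff act_signed signed_simps add.commute[of n m] mult.commute[of n m])
        (simp add: signed_def algebra_simps)
    have last: "lact (rb_bracket lact ract m n f g (butlast xs) (butlast us)) (last us) =
        Y1 - signed (m * n) Y2"
      unfolding Y1_def Y2_def rb_bracket_def by (simp add: signed_apply act_diff act_signed)
    define T1 T2 where "T1 = signed (Suc n) S1" and "T2 = signed (n * m + Suc m) S2"
    have swap: "signed (Suc m) S2 = signed (m * n) T2" "signed (m * n + Suc n) S1 = signed (m * n) T1"
      by (simp_all add: T1_def T2_def signed_def mult.commute)
    have "mda_bracket (m + 1) (n + 1) (ext_theta m f) (ext_theta n g) xs r us =
        (if r = 1 then X1 else 0) + (if r = Suc (m + n) then Y1 else 0)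
        + (if r = Suc n then signed (m * n) T2 else 0) + (if r = Suc m then signed (m * n) T1 else 0)
        - signed (m * n) ((if r = 1 then X2 else 0) + (if r = Suc (m + n) then Y2 else 0)
        + (if r = Suc m then T1 else 0) + (if r = Suc n then T2 else 0))"
      unfolding bracket insertion_sum_ext_theta[OF f len r] insertion_sum_ext_theta[OF g len' r(1) r']
        X1_def[symmetric] X2_def[symmetric] Y1_def[symmetric] Y2_def[symmetric]
        S1_def[symmetric] S2_def[symmetric] swap T1_def[symmetric] T2_def[symmetric]
        add.commute[of n m] ..
    also have "\<dots> = (if r = 1 then X1 - signed (m * n) X2 else 0)
        + (if r = Suc (m + n) then Y1 - signed (m * n) Y2 else 0)"
      by (simp add: signed_simps(1,2))
    also have "\<dots> = ext_theta (m + n) (rb_bracket lact ract m n f g) xs r us"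
      unfolding first[symmetric] last[symmetric] using len by (simp add: ext_theta_def)
    finally show ?thesis ..
  next
    case False
    then have "ext_theta (m + n) (rb_bracket lact ract m n f g) xs r us = 0"
      by (auto simp: ext_theta_def)
    moreover have "mda_comp (m + 1) (n + 1) i F G xs r us = 0" "mda_comp (n + 1) (m + 1) i G F xs r us = 0"
      for i and F G :: "('x, 'm) mda_cochain"
      using False by (auto simp: mda_comp_def)
    ultimately show ?thesis
      unfolding bracket by (simp add: signed_simps)
  qed
qed

section \<open>Linearity and closure properties\<close>

lemma ext_theta_add: "ext_theta n (f + g) = ext_theta n f + ext_theta n g"
  by (intro ext) (auto simp: ext_theta_def act_add signed_simps)

lemma ext_theta_scale: "ext_theta n (rb_scale scaleA c f) = mda_scale scaleM c (ext_theta n f)"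
  by (intro ext)
    (auto simp: ext_theta_def rb_scale_def mda_scale_def act_scale signed_def M.scale_right_distrib)

lemma ext_theta_signed: "ext_theta n (signed e f) = signed e (ext_theta n f)"
  by (intro ext) (auto simp: ext_theta_def signed_apply act_signed signed_simps add.commute)

lemma ext_theta_cochain:
  assumes f: "f \<in> rb_cochains scaleM scaleA n"
  shows "ext_theta n f \<in> mda_cochains scaleM (n + 1)"
proof -
  have hom_f: "module_hom scaleM scaleA (\<lambda>u. f xs (us[i := u]))"
    if "length xs = n" "length us = n" "i < n" for xs us i
    using f that by (simp add: rb_cochains_def multilinear_def)
  have act: "module_hom scaleM scaleM (\<lambda>u. lact (h u) v)" "module_hom scaleM scaleM (\<lambda>u. ract v (h u))"
    if "module_hom scaleM scaleA h" for h v
    using module_hom_compose[OF that lact_hom_left] module_hom_compose[OF that ract_hom_right]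
    by (simp_all add: comp_def)
  have left: "module_hom scaleM scaleM
      (\<lambda>u. signed (Suc n) (ract (hd (us[i := u])) (f (tl xs) (tl (us[i := u])))))"
    if len: "length xs = Suc n" "length us = Suc n" "i < Suc n" for xs us i
  proof -
    have "module_hom scaleM scaleM (\<lambda>u. ract (hd (us[i := u])) (f (tl xs) (tl (us[i := u]))))"
      using len by (cases us; cases i) (auto intro!: act hom_f ract_hom_left)
    then show ?thesis
      by (auto simp: signed_def module_hom_iff)
  qed
  have right: "module_hom scaleM scaleM
      (\<lambda>u. lact (f (butlast xs) (butlast (us[i := u]))) (last (us[i := u])))"
    if len: "length xs = Suc n" "length us = Suc n" "i < Suc n" for xs us i
  proof (cases "i = n")
    case True
    moreover have "us \<noteq> []" using len by auto
    ultimately have "butlast (us[i := u]) = butlast us" "last (us[i := u]) = u" for u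
      using len by (auto simp: butlast_list_update last_list_update)
    then show ?thesis by (simp add: lact_hom_right)
  next
    case False
    moreover have "us \<noteq> []" using len by auto
    ultimately have "butlast (us[i := u]) = (butlast us)[i := u]" "last (us[i := u]) = last us" for u
      using len by (auto simp: butlast_list_update last_list_update)
    then show ?thesis using len False by (auto intro!: act hom_f)
  qed
  have zero: "module_hom scaleM scaleM (\<lambda>u. 0)"
    by (simp add: module_hom_iff M.module_axioms)
  have sum: "module_hom scaleM scaleM (\<lambda>u. h u + h' u)"
    if "module_hom scaleM scaleM h" "module_hom scaleM scaleM h'" for h h'
    using that by (auto simp: module_hom_iff M.scale_right_distrib)
  have guard: "module_hom scaleM scaleM (\<lambda>u. if b then h u else 0)" if "module_hom scaleM scaleM h" for b h
    using that zero by (cases b) simp_all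
  have "module_hom scaleM scaleM (\<lambda>u. ext_theta n f xs r (us[i := u]))"
    if "length xs = Suc n" "length us = Suc n" "i < Suc n" for xs r us i
    using that unfolding ext_theta_def length_list_update
    by (simp only: simp_thms if_True) (intro sum guard left right that)
  then have "multilinear scaleM scaleM (n + 1) (ext_theta n f xs r)" if "length xs = n + 1" for xs r
    using that by (simp add: multilinear_def ext_theta_def)
  moreover have "ext_theta n f (xs[r - 1 := x]) r = ext_theta n f xs r"
    if "length xs = n + 1" for xs r x
  proof -
    have "tl (xs[0 := x]) = tl xs" using that by (cases xs) auto
    moreover have "butlast (xs[n := x]) = butlast xs" using that by (simp add: butlast_list_update)
    ultimately show ?thesis by (auto simp: ext_theta_def fun_eq_iff)
  qed
  ultimately show ?thesis
    unfolding mda_cochains_def by (auto simp: ext_theta_def fun_eq_iff)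
qed

lemma graded_lie_morphism_theta:
  "graded_lie_morphism
      (rb_cochains scaleM scaleA :: nat \<Rightarrow> ('x, 'm, 'a) rb_cochain set)
      (rb_scale scaleA) (rb_bracket lact ract)
      (\<lambda>n. mda_cochains scaleM (n + 1)) (mda_scale scaleM) (\<lambda>m n. mda_bracket (m + 1) (n + 1))
      (theta lact ract)"
  unfolding graded_lie_morphism_def linear_between_def
  by (auto simp: theta_eq_ext_theta ext_theta_add ext_theta_scale
      intro!: ext_theta_cochain[simplified] ext_theta_rb_bracket[simplified])

end

lemma mda_comp_add_left: "mda_comp k l i (f + f') g = mda_comp k l i f g + mda_comp k l i f' g"
  by (intro ext) (simp add: mda_comp_def Let_def sum.distrib)

lemma mda_comp_scale_left:
  assumes "module s"
  shows "mda_comp k l i (mda_scale s c f) g = mda_scale s c (mda_comp k l i f g)"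
  by (intro ext)
    (simp add: mda_comp_def mda_scale_def Let_def module.scale_sum_right[OF assms]
      module.scale_zero_right[OF assms])

text \<open>
  In contrast to the first slot, the second one is linear only because the inner operation is
  inserted into an argument of a multilinear map.
\<close>

lemma mda_comp_hom_right:
  fixes f g g' :: "('x, 'd::ab_group_add) mda_cochain"
  assumes s: "module s" and f: "f \<in> mda_cochains s k" and i: "1 \<le> i" "i \<le> k"
  shows "mda_comp k l i f (g + g') = mda_comp k l i f g + mda_comp k l i f g'"
    "mda_comp k l i f (mda_scale s c g) = mda_scale s c (mda_comp k l i f g)"
proof -
  have hom: "module_hom s s (\<lambda>u. f (segment xs 1 (i - 1) @ [x] @ segment xs (i + l) (k + l - 1)) q
      (segment as 1 (i - 1) @ [u] @ segment as (i + l) (k + l - 1)))"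
    if "length xs = k + l - 1" "length as = k + l - 1" for xs :: "'x list" and x q as
  proof -
    have eq: "segment ws 1 (i - 1) @ [w] @ segment ws (i + l) (k + l - 1) = replace_block ws (i - 1) l w"
      if "length ws = k + l - 1" for ws :: "'z list" and w
      using that i by (simp add: segment_def replace_block_def)
    show ?thesis
    proof (cases "q \<in> {1..k}")
      case True
      then have "multilinear s s k (f (replace_block xs (i - 1) l x) q)"
        using f that i by (simp add: mda_cochains_def length_replace_block)
      then show ?thesis
        using that i by (auto simp only: eq intro!: multilinear_replace_block)
    next
      case False
      then have "f ys q = 0" for ys using f by (auto simp: mda_cochains_def)
      then show ?thesis using s by (simp add: module_hom_iff module.scale_zero_right)
    qed
  qed
  show "mda_comp k l i f (g + g') = mda_comp k l i f g + mda_comp k l i f g'"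
    by (intro ext) (simp add: mda_comp_def Let_def sum.distrib module_hom.add[OF hom, simplified])
  show "mda_comp k l i f (mda_scale s c g) = mda_scale s c (mda_comp k l i f g)"
    by (intro ext) (simp add: mda_comp_def mda_scale_def Let_def module_hom.scale[OF hom, simplified]
      module.scale_sum_right[OF s] module.scale_zero_right[OF s])
qed

lemma mda_bracket_hom_right:
  fixes f g g' :: "('x, 'd::ab_group_add) mda_cochain"
  assumes s: "module s" and f: "f \<in> mda_cochains s k"
  shows "mda_bracket k l f (g + g') = mda_bracket k l f g + mda_bracket k l f g'"
    "mda_bracket k l f (mda_scale s c g) = mda_scale s c (mda_bracket k l f g)"
proof -
  have scale_signed: "signed e (mda_scale s c h) = mda_scale s c (signed e h)" for e and h :: "('x, 'd) mda_cochain"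
    by (intro ext) (simp add: signed_def mda_scale_def module.scale_minus_right[OF s])
  have scale_sum: "(\<Sum>i\<in>I. mda_scale s c (h i)) = mda_scale s c (sum h I)"
    for I and h :: "nat \<Rightarrow> ('x, 'd) mda_cochain"
    by (intro ext) (simp add: sum_fun_apply mda_scale_def module.scale_sum_right[OF s])
  have scale_diff: "mda_scale s c h - mda_scale s c h' = mda_scale s c (h - h')"
    for h h' :: "('x, 'd) mda_cochain"
    by (intro ext) (simp add: mda_scale_def module.scale_right_diff_distrib[OF s])
  show "mda_bracket k l f (g + g') = mda_bracket k l f g + mda_bracket k l f g'"
    by (simp add: mda_bracket_def mda_comp_hom_right(1)[OF s f] mda_comp_add_left signed_simps(2)
        sum.distrib cong: sum.cong_simp)
  show "mda_bracket k l f (mda_scale s c g) = mda_scale s c (mda_bracket k l f g)"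
    by (simp add: mda_bracket_def mda_comp_hom_right(2)[OF s f] mda_comp_scale_left[OF s] scale_signed
        scale_sum scale_diff cong: sum.cong_simp)
qed

section \<open>Differentials and cohomology\<close>

lemma image_set_plus:
  assumes "\<And>v w. \<phi> (v + w) = \<phi> v + \<phi> w"
  shows "\<phi> ` (S + T) = \<phi> ` S + \<phi> ` T"
  by (force simp: set_plus_def assms)

lemma set_plus_absorb:
  fixes B :: "'v::ab_group_add set"
  assumes "T \<noteq> {}" "T \<subseteq> B" and sub: "\<And>b b'. b \<in> B \<Longrightarrow> b' \<in> B \<Longrightarrow> b - b' \<in> B"
  shows "T + B = B"
proof
  have add: "b + b' \<in> B" if "b \<in> B" "b' \<in> B" for b b'
    using sub[OF that(1) sub[OF sub[OF that(2) that(2)] that(2)]] by simp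
  show "T + B \<subseteq> B"
    using add assms(2) by (auto simp: set_plus_def)
  obtain t where "t \<in> T" using assms(1) by blast
  show "B \<subseteq> T + B"
  proof
    fix b assume "b \<in> B"
    then have "t + (b - t) \<in> T + B" using \<open>t \<in> T\<close> assms(2) sub by blast
    then show "b \<in> T + B" by simp
  qed
qed

text \<open>
  The induced map is the image of a coset, enlarged to a full coset of \<open>B'\<close>.  This formula involves
  no choice of representatives, so well-definedness reduces to absorbing \<open>\<phi> ` B\<close> in \<open>B'\<close>.
\<close>

lemma linear_between_cosets:
  fixes \<phi> :: "'v::ab_group_add \<Rightarrow> 'w::ab_group_add"
    and s :: "'k \<Rightarrow> 'v \<Rightarrow> 'v" and s' :: "'k \<Rightarrow> 'w \<Rightarrow> 'w"
  assumes add: "\<And>v w. \<phi> (v + w) = \<phi> v + \<phi> w"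
    and scale: "\<And>c v. \<phi> (s c v) = s' c (\<phi> v)"
    and scale_add: "\<And>c v w. s' c (v + w) = s' c v + s' c w"
    and Z: "\<phi> ` Z \<subseteq> Z'" and B: "\<phi> ` B \<subseteq> B'" "B \<noteq> {}"
    and B'_diff: "\<And>b b'. b \<in> B' \<Longrightarrow> b' \<in> B' \<Longrightarrow> b - b' \<in> B'"
    and B'_scale: "\<And>c b. b \<in> B' \<Longrightarrow> s' c b \<in> B'"
  shows "linear_between ((\<lambda>f. f +o B) ` Z) (coset_scale s B) ((\<lambda>f. f +o B') ` Z') (coset_scale s' B')
      (\<lambda>S. \<phi> ` S + B')"
    and "\<phi> ` (f +o B) + B' = \<phi> f +o B'"
proof -
  have absorb: "\<phi> ` B + B' = B'" "B' + B' = B'" "s' c ` B' + B' = B'" for c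
    using B B'_scale by (intro set_plus_absorb B'_diff; blast)+
  have coset: "\<phi> ` (f +o B) + B' = \<phi> f +o B'" for f
  proof -
    have "\<phi> ` (f +o B) = \<phi> f +o \<phi> ` B"
      by (force simp: elt_set_plus_def add)
    then show ?thesis by (simp add: set_plus_rearrange3 absorb)
  qed
  then show "\<phi> ` (f +o B) + B' = \<phi> f +o B'" .
  have "\<phi> ` S + B' \<in> (\<lambda>f. f +o B') ` Z'" if "S \<in> (\<lambda>f. f +o B) ` Z" for S
    using that Z coset by blast
  moreover have "\<phi> ` (S + S') + B' = (\<phi> ` S + B') + (\<phi> ` S' + B')" for S S'
  proof -
    have "\<phi> ` (S + S') + B' = \<phi> ` S + \<phi> ` S' + (B' + B')"
      by (simp add: image_set_plus[of \<phi>, OF add] absorb)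
    then show ?thesis by (simp add: ac_simps)
  qed
  moreover have "\<phi> ` coset_scale s B c S + B' = coset_scale s' B' c (\<phi> ` S + B')" for c S
  proof -
    have "\<phi> ` coset_scale s B c S + B' = s' c ` \<phi> ` S + (\<phi> ` B + B')"
      by (simp add: coset_scale_def image_set_plus[of \<phi>, OF add] image_image scale add.assoc)
    also have "\<dots> = s' c ` \<phi> ` S + (s' c ` B' + B')"
      by (simp add: absorb)
    also have "\<dots> = coset_scale s' B' c (\<phi> ` S + B')"
      by (simp add: coset_scale_def image_set_plus[of "s' c", OF scale_add] add.assoc)
    finally show ?thesis .
  qed
  ultimately show "linear_between ((\<lambda>f. f +o B) ` Z) (coset_scale s B) ((\<lambda>f. f +o B') ` Z')
      (coset_scale s' B') (\<lambda>S. \<phi> ` S + B')"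
    by (simp add: linear_between_def)
qed

context matching_relative_rota_baxter
begin

lemma rb_element_cochain: "rb_element P \<in> rb_cochains scaleM scaleA 1"
proof -
  have "multilinear scaleM scaleA 1 (rb_element P xs)" if "length xs = 1" for xs :: "'x list"
  proof -
    have "module_hom scaleM scaleA (\<lambda>u. rb_element P xs (us[i := u]))"
      if "length us = 1" "i < 1" for us i
      using that \<open>length xs = 1\<close> P_hom by (simp add: rb_element_def entry_def)
    then show ?thesis using that by (auto simp: multilinear_def rb_element_def)
  qed
  then show ?thesis by (auto simp: rb_cochains_def rb_element_def fun_eq_iff)
qed

lemma ext_theta_rb_element:
  "ext_theta 1 (rb_element P) = mda_pi (induced_prec ract P) (induced_succ lact P)"
proof (intro ext)
  fix xs :: "'x list" and r us
  show "ext_theta 1 (rb_element P) xs r us = mda_pi (induced_prec ract P) (induced_succ lact P) xs r us"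
  proof (cases "length xs = 2 \<and> length us = 2")
    case True
    then obtain x y u v where "xs = [x, y]" "us = [u, v]"
      by (auto simp: numeral_2_eq_2 length_Suc_conv)
    then show ?thesis
      by (simp add: ext_theta_def mda_pi_def rb_element_def entry_def induced_prec_def
          induced_succ_def signed_def)
  qed (auto simp: ext_theta_def mda_pi_def)
qed

text \<open>
  The differentials are brackets with \<open>P\<close> and with its image \<open>\<pi>\<close>, with signs \<open>(-1)\<^sup>n\<close> and, since the
  extension of \<open>f\<close> has arity \<open>n + 1\<close>, \<open>(-1)\<^sup>n\<^sup>+\<^sup>2\<close>.
\<close>

lemma ext_theta_rb_diff:
  assumes f: "f \<in> rb_cochains scaleM scaleA n"
  shows "ext_theta (n + 1) (rb_diff lact ract P n f) =
    mda_diff (induced_prec ract P) (induced_succ lact P) (n + 1) (ext_theta n f)"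
proof -
  have "ext_theta (n + 1) (rb_bracket lact ract 1 n (rb_element P) f) =
      mda_bracket 2 (n + 1) (mda_pi (induced_prec ract P) (induced_succ lact P)) (ext_theta n f)"
    using ext_theta_rb_bracket[OF rb_element_cochain f, unfolded ext_theta_rb_element one_add_one]
    by (simp only: add.commute)
  then show ?thesis
    by (simp add: rb_diff_def mda_diff_def ext_theta_signed) (simp add: signed_def)
qed

lemma mda_diff_hom:
  fixes f g :: "('x, 'm) mda_cochain"
  shows "mda_diff (induced_prec ract P) (induced_succ lact P) n (f + g) =
      mda_diff (induced_prec ract P) (induced_succ lact P) n f
      + mda_diff (induced_prec ract P) (induced_succ lact P) n g"
    and "mda_diff (induced_prec ract P) (induced_succ lact P) n (mda_scale scaleM c f) =
      mda_scale scaleM c (mda_diff (induced_prec ract P) (induced_succ lact P) n f)"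
proof -
  have pi: "mda_pi (induced_prec ract P) (induced_succ lact P) \<in> mda_cochains scaleM 2"
    using ext_theta_cochain[OF rb_element_cochain, unfolded ext_theta_rb_element one_add_one] .
  note hom = mda_bracket_hom_right[OF M.module_axioms pi]
  show "mda_diff (induced_prec ract P) (induced_succ lact P) n (f + g) =
      mda_diff (induced_prec ract P) (induced_succ lact P) n f
      + mda_diff (induced_prec ract P) (induced_succ lact P) n g"
    by (simp add: mda_diff_def hom signed_simps)
  show "mda_diff (induced_prec ract P) (induced_succ lact P) n (mda_scale scaleM c f) =
      mda_scale scaleM c (mda_diff (induced_prec ract P) (induced_succ lact P) n f)"
    by (simp add: mda_diff_def hom signed_def)
      (simp add: mda_scale_def fun_eq_iff M.scale_minus_right)
qed

text \<open>
  For \<open>n = 1\<close> the coboundaries are images of elements of \<open>A\<close>; the extension in degree \<open>0\<close>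
  exhibits their images under \<open>\<theta>\<close> as coboundaries.
\<close>

lemma theta_cohomology:
  fixes n :: nat
  defines "C \<equiv> rb_cochains scaleM scaleA :: nat \<Rightarrow> ('x, 'm, 'a) rb_cochain set"
    and "d \<equiv> rb_diff lact ract P"
    and "C' \<equiv> mda_cochains scaleM"
    and "d' \<equiv> mda_diff (induced_prec ract P) (induced_succ lact P)"
  defines "B \<equiv> coboundaries 0 C d" and "B' \<equiv> coboundaries 1 C' d'"
  assumes n: "1 \<le> n"
  shows "linear_between
      (cohomology 0 C d n) (coset_scale (rb_scale scaleA) (B n))
      (cohomology 1 C' d' (n + 1)) (coset_scale (mda_scale scaleM) (B' (n + 1)))
      (\<lambda>S. theta lact ract n ` S + B' (n + 1))"
    and "f \<in> cocycles C d n \<Longrightarrow> theta lact ract n f \<in> cocycles C' d' (n + 1)"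
    and "theta lact ract n ` (f +o B n) + B' (n + 1) = theta lact ract n f +o B' (n + 1)"
proof -
  obtain k where k: "n = k + 1" using n by (metis add.commute le_Suc_ex)
  have B: "B n = d k ` C k" and B': "B' (n + 1) = d' n ` C' n"
    using n by (simp_all add: B_def B'_def coboundaries_def k)
  have theta: "theta lact ract n = (ext_theta n :: ('x, 'm, 'a) rb_cochain \<Rightarrow> _)"
    using theta_eq_ext_theta[OF n] by blast
  have diff: "ext_theta (j + 1) (d j g) = d' (j + 1) (ext_theta j g)" if "g \<in> C j" for j g
    using that ext_theta_rb_diff by (simp add: C_def d_def d'_def)
  have cochain: "ext_theta j g \<in> C' (j + 1)" if "g \<in> C j" for j g
    using that ext_theta_cochain by (simp add: C_def C'_def)
  have zero: "ext_theta j 0 = (0 :: ('x, 'm) mda_cochain)" for j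
    using ext_theta_add[of j 0 0] by simp
  show cocycle: "theta lact ract n f \<in> cocycles C' d' (n + 1)" if "f \<in> cocycles C d n" for f
    using that cochain[of f n] diff[of f n] zero by (simp add: cocycles_def theta)
  have image: "theta lact ract n ` B n \<subseteq> B' (n + 1)"
    unfolding theta B B' using diff cochain by (auto simp: k)
  have "0 \<in> C k"
    by (auto simp: C_def rb_cochains_def multilinear_def module_hom_iff module_axioms M.module_axioms)
  then have ne: "B n \<noteq> {}"
    unfolding B by blast
  have scaled: "mda_scale scaleM c b \<in> B' (n + 1)" if b: "b \<in> B' (n + 1)" for b c
  proof -
    obtain h where h: "h \<in> C' n" "b = d' n h"
      using b unfolding B' by blast
    then have "mda_scale scaleM c b = d' n (mda_scale scaleM c h)" "mda_scale scaleM c h \<in> C' n"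
      by (simp_all add: d'_def mda_diff_hom(2) C'_def mda_cochains_scale M.module_axioms)
    then show ?thesis unfolding B' by blast
  qed
  have diffs: "b - b' \<in> B' (n + 1)" if "b \<in> B' (n + 1)" "b' \<in> B' (n + 1)" for b b'
  proof -
    have plus: "b + b' \<in> B' (n + 1)" if b: "b \<in> B' (n + 1)" "b' \<in> B' (n + 1)" for b b'
    proof -
      obtain h h' where h: "h \<in> C' n" "b = d' n h" "h' \<in> C' n" "b' = d' n h'"
        using b unfolding B' by blast
      then have "b + b' = d' n (h + h')" "h + h' \<in> C' n"
        by (simp_all add: d'_def mda_diff_hom(1) C'_def mda_cochains_add)
      then show ?thesis unfolding B' by blast
    qed
    have "mda_scale scaleM (- 1) b' = - b'"
      by (simp add: mda_scale_def fun_eq_iff)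
    then show ?thesis using plus[OF that(1) scaled[OF that(2), of "- 1"]] by simp
  qed
  have cocycles: "theta lact ract n ` cocycles C d n \<subseteq> cocycles C' d' (n + 1)"
    using cocycle by blast
  have scale_add: "mda_scale scaleM c (v + w) = mda_scale scaleM c v + mda_scale scaleM c w"
    for c and v w :: "('x, 'm) mda_cochain"
    by (simp add: mda_scale_def fun_eq_iff M.scale_right_distrib)
  have hom: "theta lact ract n (v + w) = theta lact ract n v + theta lact ract n w"
    "theta lact ract n (rb_scale scaleA c v) = mda_scale scaleM c (theta lact ract n v)"
    for c and v w :: "('x, 'm, 'a) rb_cochain"
    by (simp_all add: theta ext_theta_add ext_theta_scale)
  note cosets = linear_between_cosets[of "theta lact ract n" "rb_scale scaleA" "mda_scale scaleM"
      "cocycles C d n" "cocycles C' d' (n + 1)" "B n" "B' (n + 1)", OF hom scale_add cocycles image ne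
      diffs scaled]
  show "linear_between
      (cohomology 0 C d n) (coset_scale (rb_scale scaleA) (B n))
      (cohomology 1 C' d' (n + 1)) (coset_scale (mda_scale scaleM) (B' (n + 1)))
      (\<lambda>S. theta lact ract n ` S + B' (n + 1))"
    unfolding cohomology_def B_def[symmetric] B'_def[symmetric] by (rule cosets(1))
  show "theta lact ract n ` (f +o B n) + B' (n + 1) = theta lact ract n f +o B' (n + 1)"
    by (rule cosets(2))
qed

end

theorem proposition6p6:
  fixes scaleA :: "'k::comm_ring_1 \<Rightarrow> 'a::ring \<Rightarrow> 'a"
    and scaleM :: "'k \<Rightarrow> 'm::ab_group_add \<Rightarrow> 'm"
    and lact :: "'a \<Rightarrow> 'm \<Rightarrow> 'm"
    and ract :: "'m \<Rightarrow> 'a \<Rightarrow> 'm"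
    and P :: "'x \<Rightarrow> 'm \<Rightarrow> 'a"
  assumes "CHAR('k) \<noteq> 2"
    and "matching_relative_rota_baxter scaleA scaleM lact ract P"
  shows
    "graded_lie_morphism
        (rb_cochains scaleM scaleA :: nat \<Rightarrow> ('x, 'm, 'a) rb_cochain set)
        (rb_scale scaleA) (rb_bracket lact ract)
        (\<lambda>n. mda_cochains scaleM (n + 1)) (mda_scale scaleM) (\<lambda>m n. mda_bracket (m + 1) (n + 1))
        (theta lact ract)
     \<and> (let C = (rb_cochains scaleM scaleA :: nat \<Rightarrow> ('x, 'm, 'a) rb_cochain set);
            d = rb_diff lact ract P;
            B = coboundaries 0 C d;
            C' = mda_cochains scaleM;
            d' = mda_diff (induced_prec ract P) (induced_succ lact P);
            B' = coboundaries 1 C' d'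
        in \<exists>\<Theta>. \<forall>n\<ge>1.
             linear_between
               (cohomology 0 C d n) (coset_scale (rb_scale scaleA) (B n))
               (cohomology 1 C' d' (n + 1)) (coset_scale (mda_scale scaleM) (B' (n + 1)))
               (\<Theta> n)
             \<and> (\<forall>f\<in>cocycles C d n.
                   theta lact ract n f \<in> cocycles C' d' (n + 1)
                   \<and> \<Theta> n (f +o B n) = theta lact ract n f +o B' (n + 1)))"
proof -
  interpret matching_relative_rota_baxter scaleA scaleM lact ract P by fact
  show ?thesis
    unfolding Let_def
    by (intro conjI graded_lie_morphism_theta
        exI[of _ "\<lambda>n S. theta lact ract n ` S + coboundaries 1 (mda_cochains scaleM)
          (mda_diff (induced_prec ract P) (induced_succ lact P)) (n + 1)"] allI impI ballI
        theta_cohomology)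
qed

end
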